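(* Let $p$ be a prime, $n\ge 1$ an integer and $F=GF(p^n)$. Let $A(n,p)$ be the group $$\left\{V(a,b,c)=\begin{bmatrix}1&0&0\\ a&1&0\\ b&c&1\end{bmatrix} : a,b,c\in F\right\}$$ under matrix multiplication, which is given by $V(a,b,c)V(a',b',c')=V(a+a',\,b+b'+ca',\,c+c')$. Then $$\text{L-Spec}(\Gamma_{A(n,p)})=\{0^{p^n+1},\ (p^{2n}-p^n)^{p^{3n}-2p^n-1}\}$$ and $$\text{Q-Spec}(\Gamma_{A(n,p)})=\{(2p^{2n}-2p^n-2)^{p^n+1},\ (p^{2n}-p^n-2)^{p^{3n}-2p^n-1}\}.$$
   Context: The commuting graph $\Gamma_G$ of a finite non-abelian group $G$ with center $Z(G)$ is the simple undirected graph with vertex set $G\setminus Z(G)$ in which two distinct vertices $x,y$ are adjacent if and only if $xy=yx$. For a finite graph $\mathcal{G}$ with adjacency matrix $A$ and (diagonal) degree matrix $D$, $\text{L-Spec}(\mathcal{G})$ and $\text{Q-Spec}(\mathcal{G})$ denote the multisets of eigenvalues (with multiplicity) of the Laplacian matrix $D-A$ and of the signless Laplacian matrix $D+A$, respectively. The notation $\{\alpha_1^{a_1},\dots,\alpha_l^{a_l}\}$ means the multiset in which $\alpha_i$ is listed $a_i$ times (the outermost exponent is the multiplicity). *)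

theory Defs
  imports
    "HOL-Algebra.Group"
    "HOL-Computational_Algebra.Primes"
    "HOL-Library.Cardinality"
    "Jordan_Normal_Form.Char_Poly"
    "Graph_Theory.Pair_Digraph"
begin

section \<open>The commuting graph of a group\<close>

definition group_center :: "('a, 'b) monoid_scheme \<Rightarrow> 'a set" where
  "group_center G = {z \<in> carrier G. \<forall>x\<in>carrier G. z \<otimes>\<^bsub>G\<^esub> x = x \<otimes>\<^bsub>G\<^esub> z}"

text \<open>
  As throughout \<open>Graph_Theory\<close>, an undirected simple graph is a loop-free symmetric digraph
  (locale \<^locale>\<open>pair_graph\<close>): the edge \<open>{x, y}\<close> is the pair of arcs \<open>(x, y)\<close>, \<open>(y, x)\<close>.
\<close>

definition commuting_graph :: "('a, 'b) monoid_scheme \<Rightarrow> 'a pair_pre_digraph" where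
  "commuting_graph G =
     \<lparr> pverts = carrier G - group_center G,
       parcs = {(x, y). x \<in> carrier G - group_center G \<and> y \<in> carrier G - group_center G \<and>
                        x \<noteq> y \<and> x \<otimes>\<^bsub>G\<^esub> y = y \<otimes>\<^bsub>G\<^esub> x} \<rparr>"

lemma pair_graph_commuting_graph:
  assumes "finite (carrier G)"
  shows "pair_graph (commuting_graph G)"
proof unfold_locales
  have "parcs (commuting_graph G) \<subseteq> carrier G \<times> carrier G"
    by (auto simp: commuting_graph_def)
  then show "finite (parcs (commuting_graph G))"
    using assms by (meson finite_SigmaI finite_subset)
qed (use assms in \<open>auto simp: commuting_graph_def symmetric_def sym_def\<close>)


section \<open>Laplacian and signless Laplacian spectra\<close>

text \<open>
  Matrices are indexed by \<open>{0..<n}\<close>, so they are formed with respect to a list \<open>vs\<close>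
  enumerating the vertices.  In a symmetric digraph the degree of a vertex is its out-degree.
\<close>

definition adjacency_matrix :: "'a pair_pre_digraph \<Rightarrow> 'a list \<Rightarrow> complex mat" where
  "adjacency_matrix G vs = mat (length vs) (length vs)
     (\<lambda>(i, j). if (vs ! i, vs ! j) \<in> parcs G then 1 else 0)"

definition degree_matrix :: "'a pair_pre_digraph \<Rightarrow> 'a list \<Rightarrow> complex mat" where
  "degree_matrix G vs = mat (length vs) (length vs)
     (\<lambda>(i, j). if i = j then of_nat (out_degree (with_proj G) (vs ! i)) else 0)"

definition laplacian_matrix :: "'a pair_pre_digraph \<Rightarrow> 'a list \<Rightarrow> complex mat" where
  "laplacian_matrix G vs = degree_matrix G vs - adjacency_matrix G vs"

definition signless_laplacian_matrix :: "'a pair_pre_digraph \<Rightarrow> 'a list \<Rightarrow> complex mat" where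
  "signless_laplacian_matrix G vs = degree_matrix G vs + adjacency_matrix G vs"

definition eigenvalue_mset :: "complex mat \<Rightarrow> complex multiset" where
  "eigenvalue_mset M = proots (char_poly M)"

definition is_enumeration :: "'a set \<Rightarrow> 'a list \<Rightarrow> bool" where
  "is_enumeration V vs \<longleftrightarrow> distinct vs \<and> set vs = V"

text \<open>
  The choice of the enumeration is immaterial, see \<open>L_Spec_eq\<close> and \<open>Q_Spec_eq\<close> below.
\<close>

definition L_Spec :: "'a pair_pre_digraph \<Rightarrow> complex multiset" where
  "L_Spec G = eigenvalue_mset (laplacian_matrix G (SOME vs. is_enumeration (pverts G) vs))"

definition Q_Spec :: "'a pair_pre_digraph \<Rightarrow> complex multiset" where
  "Q_Spec G = eigenvalue_mset (signless_laplacian_matrix G (SOME vs. is_enumeration (pverts G) vs))"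

lemma char_poly_permute:
  fixes A B :: "complex mat"
  assumes A: "A \<in> carrier_mat n n" and B: "B \<in> carrier_mat n n"
    and f: "f permutes {0..<n}"
    and AB: "\<And>i j. i < n \<Longrightarrow> j < n \<Longrightarrow> B $$ (i, j) = A $$ (f i, f j)"
  shows "char_poly B = char_poly A"
proof -
  have fl: "f i < n" if "i < n" for i
    using permutes_in_image[OF f, of i] that by auto
  have fi: "f i = f j \<longleftrightarrow> i = j" for i j
    using permutes_inj[OF f] by (auto dest: injD)
  define C where "C = char_poly_matrix A"
  have C: "C \<in> carrier_mat n n" using A by (simp add: C_def)
  define R where "R = mat n n (\<lambda>(i, j). C $$ (f i, j))"
  have R: "R \<in> carrier_mat n n" by (simp add: R_def)
  have RT: "R\<^sup>T \<in> carrier_mat n n" using R by simp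
  have eq: "char_poly_matrix B = (mat n n (\<lambda>(i, j). R\<^sup>T $$ (f i, j)))\<^sup>T"
    using A B by (intro eq_matI) (auto simp: char_poly_matrix_def R_def C_def AB fl fi)
  have "det (char_poly_matrix B) = det (mat n n (\<lambda>(i, j). R\<^sup>T $$ (f i, j)))"
    unfolding eq by (rule det_transpose[where n = n]) simp
  also have "\<dots> = signof f * det R\<^sup>T"
    by (rule det_permute_rows[OF RT f])
  also have "det R\<^sup>T = det R" by (rule det_transpose[OF R])
  also have "det R = signof f * det C"
    unfolding R_def by (rule det_permute_rows[OF C f])
  finally show ?thesis
    unfolding char_poly_def C_def by (simp add: sign_def)
qed

lemma enumeration_permutation:
  assumes vs: "is_enumeration V vs" and ws: "is_enumeration V ws"
  obtains f where "f permutes {0..<length vs}" "length ws = length vs"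
    "\<And>i. i < length vs \<Longrightarrow> ws ! i = vs ! f i"
proof -
  have "mset ws = mset vs"
    using vs ws by (auto simp: is_enumeration_def set_eq_iff_mset_eq_distinct)
  then obtain f where f: "f permutes {..<length vs}" "permute_list f vs = ws"
    by (rule mset_eq_permutation)
  show thesis
    by (rule that[of f]) (use f permute_list_nth in \<open>auto simp: lessThan_atLeast0\<close>)
qed

lemma L_Spec_eq:
  assumes "is_enumeration (pverts G) vs"
  shows "L_Spec G = eigenvalue_mset (laplacian_matrix G vs)"
proof -
  define ws where "ws = (SOME vs. is_enumeration (pverts G) vs)"
  have ws: "is_enumeration (pverts G) ws"
    unfolding ws_def using assms by (rule someI)
  obtain f where f: "f permutes {0..<length vs}" "length ws = length vs"
    "\<And>i. i < length vs \<Longrightarrow> ws ! i = vs ! f i"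
    by (rule enumeration_permutation[OF assms ws]) blast
  have fl: "f i < length vs" if "i < length vs" for i
    using permutes_in_image[OF f(1), of i] that by auto
  have fi: "f i = f j \<longleftrightarrow> i = j" for i j
    using permutes_inj[OF f(1)] by (auto dest: injD)
  have "char_poly (laplacian_matrix G ws) = char_poly (laplacian_matrix G vs)"
    by (rule char_poly_permute[OF _ _ f(1)])
      (auto simp: laplacian_matrix_def degree_matrix_def adjacency_matrix_def f fl fi)
  then show ?thesis
    by (simp add: L_Spec_def eigenvalue_mset_def ws_def)
qed

lemma Q_Spec_eq:
  assumes "is_enumeration (pverts G) vs"
  shows "Q_Spec G = eigenvalue_mset (signless_laplacian_matrix G vs)"
proof -
  define ws where "ws = (SOME vs. is_enumeration (pverts G) vs)"
  have ws: "is_enumeration (pverts G) ws"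
    unfolding ws_def using assms by (rule someI)
  obtain f where f: "f permutes {0..<length vs}" "length ws = length vs"
    "\<And>i. i < length vs \<Longrightarrow> ws ! i = vs ! f i"
    by (rule enumeration_permutation[OF assms ws]) blast
  have fl: "f i < length vs" if "i < length vs" for i
    using permutes_in_image[OF f(1), of i] that by auto
  have fi: "f i = f j \<longleftrightarrow> i = j" for i j
    using permutes_inj[OF f(1)] by (auto dest: injD)
  have "char_poly (signless_laplacian_matrix G ws) = char_poly (signless_laplacian_matrix G vs)"
    by (rule char_poly_permute[OF _ _ f(1)])
      (auto simp: signless_laplacian_matrix_def degree_matrix_def adjacency_matrix_def f fl fi)
  then show ?thesis
    by (simp add: Q_Spec_def eigenvalue_mset_def ws_def)
qed


section \<open>The group \<open>A(n, p)\<close>\<close>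

definition V :: "'a :: field \<Rightarrow> 'a \<Rightarrow> 'a \<Rightarrow> 'a mat" where
  "V a b c = mat_of_rows_list 3 [[1, 0, 0], [a, 1, 0], [b, c, 1]]"

text \<open>\<open>A(n, p)\<close> is the instance where \<open>'a\<close> is a field with \<open>p ^ n\<close> elements.\<close>

definition A_group :: "'a :: field mat monoid" where
  "A_group = \<lparr> carrier = {V a b c | a b c. True}, monoid.mult = (*), one = 1\<^sub>m 3 \<rparr>"

lemma V_mult: "V a b c * V a' b' c' = V (a + a') (b + b' + c * a') (c + c')"
  by (rule eq_matI)
    (auto simp: V_def mat_of_rows_list_def scalar_prod_def numeral_3_eq_3 less_Suc_eq)

lemma V_one: "1\<^sub>m 3 = V 0 0 0"
  by (rule eq_matI)
    (auto simp: V_def mat_of_rows_list_def numeral_3_eq_3 less_Suc_eq)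

lemma V_inject: "V a b c = V a' b' c' \<longleftrightarrow> a = a' \<and> b = b' \<and> c = c'"
proof
  assume eq: "V a b c = V a' b' c'"
  have "V a b c $$ (i, j) = V a' b' c' $$ (i, j)" for i j
    by (simp add: eq)
  from this[of 1 0] this[of 2 0] this[of 2 1] show "a = a' \<and> b = b' \<and> c = c'"
    by (simp add: V_def mat_of_rows_list_def numeral_2_eq_2)
qed simp

lemma group_A_group: "group (A_group :: 'a :: field mat monoid)"
proof (rule groupI)
  fix x :: "'a mat"
  assume "x \<in> carrier A_group"
  then obtain a b c where x: "x = V a b c"
    by (auto simp: A_group_def)
  have "V (- a) (c * a - b) (- c) * V a b c = V 0 0 0"
    by (simp add: V_mult)
  then show "\<exists>y\<in>carrier A_group. y \<otimes>\<^bsub>A_group\<^esub> x = \<one>\<^bsub>A_group\<^esub>"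
    by (auto simp: A_group_def x V_one)
qed (auto simp: A_group_def V_one V_mult V_inject algebra_simps)

lemma A_group_non_abelian: "\<not> comm_group (A_group :: 'a :: field mat monoid)"
proof
  assume "comm_group (A_group :: 'a mat monoid)"
  then interpret comm_group "A_group :: 'a mat monoid" .
  have "V 1 0 0 \<otimes>\<^bsub>A_group\<^esub> V 0 0 1 = V 0 0 (1 :: 'a) \<otimes>\<^bsub>A_group\<^esub> V 1 0 0"
    by (rule m_comm) (auto simp: A_group_def)
  then show False
    by (simp add: A_group_def V_mult V_inject)
qed

end

theory Submission
  imports Defs "Jordan_Normal_Form.Schur_Decomposition"
begin

text \<open>
  Two non-central elements of \<open>A(n, p)\<close> commute iff their \<open>(a, c)\<close>-parts span the same line of
  \<open>F\<^sup>2\<close>.  Commuting is therefore an equivalence relation on the non-central elements, and the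
  commuting graph is a disjoint union of \<open>q + 1\<close> cliques with \<open>m = q\<^sup>2 - q\<close> vertices, where
  \<open>q = p\<^sup>n\<close>.  If \<open>P\<close> is the 0-1 matrix of this relation, then the two Laplacians are
  \<open>m I - P\<close> and \<open>(m - 2) I + P\<close>.  Since \<open>P\<^sup>2 = m P\<close>, each of them is annihilated by a
  quadratic polynomial with two distinct roots, and the multiplicities of these two eigenvalues
  can be read off the trace.
\<close>

section \<open>Matrices with a quadratic annihilating polynomial\<close>

text \<open>\<open>sum_list (diag_mat A)\<close> serves as the trace of \<open>A\<close>. This is
  its cyclic property, from which invariance under similarity follows.\<close>

lemma sum_list_diag_mat_mult_comm:
  fixes A B :: "'a :: comm_semiring_0 mat"
  assumes "A \<in> carrier_mat n m" "B \<in> carrier_mat m n"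
  shows "sum_list (diag_mat (A * B)) = sum_list (diag_mat (B * A))"
proof -
  have "sum_list (diag_mat (A * B)) = (\<Sum>i<n. \<Sum>j<m. A $$ (i, j) * B $$ (j, i))"
    using assms by (simp add: diag_mat_def sum_list_distinct_conv_sum_set scalar_prod_def
        atLeast0LessThan)
  also have "\<dots> = (\<Sum>j<m. \<Sum>i<n. B $$ (j, i) * A $$ (i, j))"
    by (subst sum.swap) (simp add: mult.commute)
  also have "\<dots> = sum_list (diag_mat (B * A))"
    using assms by (simp add: diag_mat_def sum_list_distinct_conv_sum_set scalar_prod_def
        atLeast0LessThan)
  finally show ?thesis .
qed

lemma sum_list_diag_mat_similar:
  fixes A B :: "'a :: comm_semiring_1 mat"
  assumes "similar_mat A B"
  shows "sum_list (diag_mat A) = sum_list (diag_mat B)"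
proof -
  obtain n P Q where carr: "{A, B, P, Q} \<subseteq> carrier_mat n n"
    and QP: "Q * P = 1\<^sub>m n" and A: "A = P * B * Q"
    using similar_matD[OF assms] by blast
  have "sum_list (diag_mat A) = sum_list (diag_mat (P * (B * Q)))"
    using carr by (simp add: A assoc_mult_mat[of _ n n _ n _ n])
  also have "\<dots> = sum_list (diag_mat ((B * Q) * P))"
    by (rule sum_list_diag_mat_mult_comm[of _ n n]) (use carr in auto)
  also have "(B * Q) * P = B"
    using carr QP by (simp add: assoc_mult_mat[of _ n n _ n _ n] right_mult_one_mat[of _ n n])
  finally show ?thesis .
qed

lemma proots_prod_list_linear:
  "proots (\<Prod>a\<leftarrow>as. [:- a, 1:]) = mset (as :: 'a :: idom list)"
proof (induction as)
  case (Cons a as)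
  have "(\<Prod>a\<leftarrow>as. [:- a, 1:]) \<noteq> 0" by (auto simp: prod_list_zero_iff)
  then have "proots ([:- a, 1:] * (\<Prod>a\<leftarrow>as. [:- a, 1:])) = {#a#} + mset as"
    by (subst proots_mult) (use Cons.IH in auto)
  then show ?case by simp
qed simp

text \<open>Over the complex numbers the characteristic polynomial splits into \<open>n\<close>
  linear factors.\<close>

lemma size_eigenvalue_mset:
  assumes "M \<in> carrier_mat n n"
  shows "size (eigenvalue_mset M) = n"
  using char_poly_factorized[OF assms]
  by (auto simp: eigenvalue_mset_def proots_prod_list_linear)

text \<open>By Schur decomposition \<open>M\<close> is similar to an upper triangular
  \<open>B\<close>, whose diagonal lists the roots of the characteristic polynomial; similarity
  preserves the trace.\<close>

lemma sum_eigenvalue_mset: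
  assumes "M \<in> carrier_mat n n"
  shows "\<Sum>\<^sub># (eigenvalue_mset M) = sum_list (diag_mat M)"
proof -
  obtain es where "char_poly M = (\<Prod>a\<leftarrow>es. [:- a, 1:])"
    using char_poly_factorized[OF assms] by blast
  then obtain B where B: "B \<in> carrier_mat n n" "upper_triangular B" "similar_mat M B"
    using schur_decomposition_exists[OF assms] by blast
  have "eigenvalue_mset M = mset (diag_mat B)"
    using char_poly_similar[OF B(3)] char_poly_upper_triangular[OF B(1,2)]
    by (simp add: eigenvalue_mset_def proots_prod_list_linear)
  then show ?thesis
    using sum_list_diag_mat_similar[OF B(3)] by (simp add: sum_mset_sum_list)
qed

lemma smult_mat_mult_vec:
  assumes "A \<in> carrier_mat nr nc" "v \<in> carrier_vec nc"
  shows "(k \<cdot>\<^sub>m A) *\<^sub>v v = k \<cdot>\<^sub>v (A *\<^sub>v v)"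
  using assms by (intro eq_vecI) (auto simp: smult_scalar_prod_distrib[of _ nc])

text \<open>The hypothesis \<open>quad\<close> says (M - a I)(M - b I) = 0. Applied to an
  eigenvector v for \<open>e\<close> it gives (e - a)(e - b) v = 0, and v has a nonzero
  coordinate.\<close>

lemma eigenvalue_of_quadratic:
  fixes M :: "'a :: field mat"
  assumes M: "M \<in> carrier_mat n n"
    and quad: "M * M = (a + b) \<cdot>\<^sub>m M - (a * b) \<cdot>\<^sub>m 1\<^sub>m n"
    and "eigenvalue M e"
  shows "e = a \<or> e = b"
proof -
  obtain v where v: "v \<in> carrier_vec n" "v \<noteq> 0\<^sub>v n" "M *\<^sub>v v = e \<cdot>\<^sub>v v"
    using \<open>eigenvalue M e\<close> M by (auto simp: eigenvalue_def eigenvector_def)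
  have "(M * M) *\<^sub>v v = e \<cdot>\<^sub>v (e \<cdot>\<^sub>v v)"
    using M v by (simp add: assoc_mult_mat_vec[of _ n n] mult_mat_vec[of _ n n])
  moreover have "(M * M) *\<^sub>v v = (a + b) \<cdot>\<^sub>v (e \<cdot>\<^sub>v v) - (a * b) \<cdot>\<^sub>v v"
    unfolding quad using M v
    by (simp add: minus_mult_distrib_mat_vec[of _ n n] smult_mat_mult_vec[of _ n n])
  ultimately have eq: "e \<cdot>\<^sub>v (e \<cdot>\<^sub>v v) = (a + b) \<cdot>\<^sub>v (e \<cdot>\<^sub>v v) - (a * b) \<cdot>\<^sub>v v" by simp
  obtain i where i: "i < n" "v $ i \<noteq> 0"
    using v by (metis carrier_vecD eq_vecI index_zero_vec)
  have "e * (e * v $ i) = (a + b) * (e * v $ i) - a * b * v $ i"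
    using arg_cong[OF eq, of "\<lambda>w. w $ i"] i v by simp
  then have "(e - a) * (e - b) * v $ i = 0" by (simp add: algebra_simps)
  then show ?thesis using i by simp
qed

text \<open>Only \<open>a\<close> and \<open>b\<close> can occur as eigenvalues, which leaves two
  unknown multiplicities. Their sum is \<open>n\<close>, and the trace gives a second linear
  equation, independent of the first because \<open>a\<close> and \<open>b\<close> differ.\<close>

lemma eigenvalue_mset_of_quadratic:
  assumes M: "M \<in> carrier_mat n n" and "a \<noteq> b" and "k \<le> n"
    and quad: "M * M = (a + b) \<cdot>\<^sub>m M - (a * b) \<cdot>\<^sub>m 1\<^sub>m n"
    and tr: "sum_list (diag_mat M) = of_nat k * a + of_nat (n - k) * b"
  shows "eigenvalue_mset M = replicate_mset k a + replicate_mset (n - k) b"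
proof -
  let ?E = "eigenvalue_mset M"
  have "char_poly M \<noteq> 0" using degree_monic_char_poly[OF M] by auto
  then have "set_mset ?E \<subseteq> {a, b}"
    using eigenvalue_of_quadratic[OF M quad]
    by (auto simp: eigenvalue_mset_def eigenvalue_root_char_poly[OF M])
  then have E: "?E = replicate_mset (count ?E a) a + replicate_mset (count ?E b) b"
    using \<open>a \<noteq> b\<close> by (intro multiset_eqI) (auto simp: not_in_iff)
  have n: "n = count ?E a + count ?E b"
    using arg_cong[OF E, of size] size_eigenvalue_mset[OF M] by simp
  have "of_nat k * a + of_nat (n - k) * b = of_nat (count ?E a) * a + of_nat (count ?E b) * b"
    using arg_cong[OF E, of sum_mset] sum_eigenvalue_mset[OF M] tr by simp
  then have "(of_nat k - of_nat (count ?E a)) * (a - b) = 0"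
    using \<open>k \<le> n\<close> n by (simp add: of_nat_diff algebra_simps)
  then have "count ?E a = k" using \<open>a \<noteq> b\<close> by simp
  with E n show ?thesis by simp
qed


section \<open>Disjoint unions of cliques of equal size\<close>

lemma sum_nth_distinct:
  assumes "distinct xs"
  shows "(\<Sum>i<length xs. f (xs ! i)) = sum f (set xs)"
  by (rule sum.reindex_bij_betw[OF bij_betw_nth[OF assms]]) auto

text \<open>Here M = \<alpha> I + \<beta> P, with P the 0-1 matrix of \<open>R\<close>. From P^2 = m
  P follows (M - \<alpha> I)^2 = \<beta> m (M - \<alpha> I), so the two roots are \<alpha> + \<beta>
  m and \<alpha>. The parameters allow one argument for both Laplacians.\<close>

lemma eigenvalue_mset_equiv_matrix:
  fixes \<alpha> \<beta> :: complex
  assumes R: "equiv (set vs) R" and vs: "distinct vs"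
    and cls: "\<And>x. x \<in> set vs \<Longrightarrow> card (R `` {x}) = m"
    and len: "length vs = k * m" and "m > 0" and "\<beta> \<noteq> 0"
  defines "M \<equiv> mat (length vs) (length vs)
    (\<lambda>(i, j). (if i = j then \<alpha> else 0) + (if (vs ! i, vs ! j) \<in> R then \<beta> else 0))"
  shows "eigenvalue_mset M =
    replicate_mset k (\<alpha> + \<beta> * of_nat m) + replicate_mset (k * m - k) \<alpha>"
proof -
  let ?N = "length vs"
  let ?P = "\<lambda>i j. if (vs ! i, vs ! j) \<in> R then \<beta> else 0"
  have M: "M \<in> carrier_mat ?N ?N" by (simp add: M_def)
  \<comment> \<open>Only the \<open>m\<close> indices l in the class of i contribute, and for each
    of these l is related to j iff i is.\<close>
  have PP: "(\<Sum>l<?N. ?P i l * ?P l j) = \<beta> * of_nat m * ?P i j" if "i < ?N" "j < ?N" for i j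
  proof -
    have i: "vs ! i \<in> set vs" using that by simp
    have "R `` {vs ! i} \<subseteq> set vs" using R by (auto dest: equiv_type)
    have "(\<Sum>l<?N. ?P i l * ?P l j) =
        (\<Sum>x\<in>set vs. if x \<in> R `` {vs ! i} then \<beta> * ?P i j else 0)"
      unfolding sum_nth_distinct[OF vs,
          of "\<lambda>x. (if (vs ! i, x) \<in> R then \<beta> else 0) * (if (x, vs ! j) \<in> R then \<beta> else 0)"]
      using R by (intro sum.cong) (auto elim!: equivE dest: symD transD)
    also have "\<dots> = of_nat (card (R `` {vs ! i})) * (\<beta> * ?P i j)"
      using \<open>R `` {vs ! i} \<subseteq> set vs\<close> by (simp add: sum.If_cases Int_absorb1 del: Image_singleton_iff)
    finally show ?thesis using cls[OF i] by simp
  qed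
  have "M * M = ((\<alpha> + \<beta> * of_nat m) + \<alpha>) \<cdot>\<^sub>m M - ((\<alpha> + \<beta> * of_nat m) * \<alpha>) \<cdot>\<^sub>m 1\<^sub>m ?N"
  proof (rule eq_matI)
    fix i j
    assume "i < dim_row (((\<alpha> + \<beta> * of_nat m) + \<alpha>) \<cdot>\<^sub>m M - ((\<alpha> + \<beta> * of_nat m) * \<alpha>) \<cdot>\<^sub>m 1\<^sub>m ?N)"
      and "j < dim_col (((\<alpha> + \<beta> * of_nat m) + \<alpha>) \<cdot>\<^sub>m M - ((\<alpha> + \<beta> * of_nat m) * \<alpha>) \<cdot>\<^sub>m 1\<^sub>m ?N)"
    then have ij: "i < ?N" "j < ?N" by auto
    define d where "d = (\<lambda>i j :: nat. if i = j then \<alpha> else 0 :: complex)"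
    have "(M * M) $$ (i, j) = (\<Sum>l<?N. (d i l + ?P i l) * (d l j + ?P l j))"
      using ij by (simp add: M_def scalar_prod_def d_def atLeast0LessThan)
    also have "\<dots> = (\<Sum>l<?N. d i l * d l j) + (\<Sum>l<?N. d i l * ?P l j)
        + (\<Sum>l<?N. ?P i l * d l j) + (\<Sum>l<?N. ?P i l * ?P l j)"
      unfolding sum.distrib[symmetric] by (intro sum.cong refl) (simp only: distrib_left distrib_right add_ac)
    also have "(\<Sum>l<?N. d i l * d l j) = \<alpha> * d i j"
      using ij by (simp add: d_def if_distrib[of "\<lambda>x. x * _"] cong: if_cong)
    also have "(\<Sum>l<?N. d i l * ?P l j) = \<alpha> * ?P i j"
      using ij by (simp add: d_def if_distrib[of "\<lambda>x. x * _"] cong: if_cong)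
    also have "(\<Sum>l<?N. ?P i l * d l j) = \<alpha> * ?P i j"
    proof -
      have "(\<Sum>l<?N. ?P i l * d l j) = (\<Sum>l<?N. if l = j then ?P i l * \<alpha> else 0)"
        by (intro sum.cong) (auto simp: d_def)
      then show ?thesis using ij by simp
    qed
    also note PP[OF ij]
    finally show "(M * M) $$ (i, j) = (((\<alpha> + \<beta> * of_nat m) + \<alpha>) \<cdot>\<^sub>m M
        - ((\<alpha> + \<beta> * of_nat m) * \<alpha>) \<cdot>\<^sub>m 1\<^sub>m ?N) $$ (i, j)"
      using ij by (simp add: M_def d_def algebra_simps)
  qed (auto simp: M_def)
  \<comment> \<open>By reflexivity every diagonal entry is \<alpha> + \<beta>; the total k m
    (\<alpha> + \<beta>) regroups as k (\<alpha> + \<beta> m) + (k m - k) \<alpha>.\<close>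
  moreover have "sum_list (diag_mat M) = of_nat k * (\<alpha> + \<beta> * of_nat m) + of_nat (?N - k) * \<alpha>"
  proof -
    have "(vs ! i, vs ! i) \<in> R" if "i < ?N" for i
      using R that by (meson equivE nth_mem refl_onD)
    then have "sum_list (diag_mat M) = of_nat (k * m) * (\<alpha> + \<beta>)"
      by (simp add: diag_mat_def M_def sum_list_distinct_conv_sum_set len[symmetric])
    moreover have "k \<le> k * m" using \<open>m > 0\<close> by simp
    ultimately show ?thesis by (simp add: len of_nat_diff algebra_simps)
  qed
  ultimately show ?thesis
    unfolding len[symmetric] using \<open>m > 0\<close> \<open>\<beta> \<noteq> 0\<close> len
    by (intro eigenvalue_mset_of_quadratic[OF M]) auto
qed

text \<open>Every degree is m - 1 and the adjacency matrix is P - I, so the previous lemma applies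
  with (\<alpha>, \<beta>) = (m, -1) for the Laplacian and (m - 2, 1) for the signless one.\<close>

lemma spectra_disjoint_cliques:
  assumes fin: "finite (pverts G)"
    and R: "equiv (pverts G) R" and arcs: "parcs G = R - Id"
    and cls: "\<And>x. x \<in> pverts G \<Longrightarrow> card (R `` {x}) = m"
    and card: "card (pverts G) = k * m" and "m > 0"
  shows "L_Spec G = replicate_mset k 0 + replicate_mset (k * m - k) (of_nat m)"
    and "Q_Spec G = replicate_mset k (2 * of_nat m - 2) + replicate_mset (k * m - k) (of_nat m - 2)"
proof -
  obtain vs where vs: "set vs = pverts G" "distinct vs"
    using finite_distinct_list[OF fin] by blast
  then have enum: "is_enumeration (pverts G) vs" by (simp add: is_enumeration_def)
  have len: "length vs = k * m" using vs card distinct_card by fastforce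
  have refl: "(x, x) \<in> R" if "x \<in> pverts G" for x
    using R that by (auto elim!: equivE dest: refl_onD)
  have deg: "out_degree (with_proj G) x = m - 1" if x: "x \<in> pverts G" for x
  proof -
    have "out_arcs (with_proj G) x = Pair x ` (R `` {x} - {x})"
      by (auto simp: out_arcs_def arcs)
    then have "out_degree (with_proj G) x = card (R `` {x} - {x})"
      by (simp add: out_degree_def card_image inj_on_def)
    then show ?thesis using refl[OF x] cls[OF x] by simp
  qed
  have *: "eigenvalue_mset (mat (length vs) (length vs)
      (\<lambda>(i, j). (if i = j then \<alpha> else 0) + (if (vs ! i, vs ! j) \<in> R then \<beta> else 0))) =
      replicate_mset k (\<alpha> + \<beta> * of_nat m) + replicate_mset (k * m - k) \<alpha>" if "\<beta> \<noteq> 0" for \<alpha> \<beta>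
    by (rule eigenvalue_mset_equiv_matrix) (use R vs cls len \<open>m > 0\<close> that in auto)
  have in_V: "vs ! i \<in> pverts G" if "i < length vs" for i
    using that vs by (metis nth_mem)
  have L: "laplacian_matrix G vs = mat (length vs) (length vs)
      (\<lambda>(i, j). (if i = j then of_nat m else 0) + (if (vs ! i, vs ! j) \<in> R then - 1 else 0))"
    using vs \<open>m > 0\<close> by (intro eq_matI) (auto simp: laplacian_matrix_def degree_matrix_def
        adjacency_matrix_def deg in_V refl arcs nth_eq_iff_index_eq of_nat_diff)
  have Q: "signless_laplacian_matrix G vs = mat (length vs) (length vs)
      (\<lambda>(i, j). (if i = j then of_nat m - 2 else 0) + (if (vs ! i, vs ! j) \<in> R then 1 else 0))"
    using vs \<open>m > 0\<close> by (intro eq_matI) (auto simp: signless_laplacian_matrix_def degree_matrix_def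
        adjacency_matrix_def deg in_V refl arcs nth_eq_iff_index_eq of_nat_diff)
  show "L_Spec G = replicate_mset k 0 + replicate_mset (k * m - k) (of_nat m)"
    unfolding L_Spec_eq[OF enum] L by (subst *) auto
  show "Q_Spec G = replicate_mset k (2 * of_nat m - 2) + replicate_mset (k * m - k) (of_nat m - 2)"
    unfolding Q_Spec_eq[OF enum] Q by (subst *) auto
qed


section \<open>The commuting graph of \<open>A(n, p)\<close>\<close>

text \<open>Only the corner entry b + b' + c a' of a product depends on the order of the
  factors.\<close>

lemma V_commute_iff: "V a b c * V a' b' c' = V a' b' c' * V a b c \<longleftrightarrow> c * a' = c' * a"
  by (auto simp: V_mult V_inject algebra_simps)

lemma V_in_group_center_iff: "V a b c \<in> group_center A_group \<longleftrightarrow> a = 0 \<and> c = 0"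
proof
  assume "V a b c \<in> group_center A_group"
  then have *: "V a b c * V a' 0 c' = V a' 0 c' * V a b c" for a' c'
    by (auto simp: group_center_def A_group_def)
  \<comment> \<open>Commuting with \<open>V 0 0 1\<close> forces a = 0, and commuting with
    \<open>V 1 0 0\<close> forces c = 0.\<close>
  show "a = 0 \<and> c = 0"
    using *[of 0 1] *[of 1 0] by (auto simp: V_commute_iff)
next
  assume "a = 0 \<and> c = 0"
  then show "V a b c \<in> group_center A_group"
    by (auto simp: group_center_def A_group_def V_commute_iff)
qed

text \<open>The coordinates are grouped as \<open>((a, c), b)\<close> because centrality and
  commutation depend on (a, c) alone; the sets to be counted thus become images of products in which
  \<open>b\<close> is free.\<close>

lemma V_in_image_iff: "V a b c \<in> (\<lambda>((a, c), b). V a b c) ` S \<longleftrightarrow> ((a, c), b) \<in> S"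
  by (force simp: V_inject)

lemma carrier_A_group: "carrier A_group = range (\<lambda>((a, c), b). V a b c)"
  by (auto simp: A_group_def V_in_image_iff)

lemma noncentral_A_group:
  "carrier A_group - group_center A_group =
    (\<lambda>((a, c), b). V a b c) ` ((UNIV - {(0, 0)}) \<times> UNIV)"
  by (auto simp: carrier_A_group V_in_image_iff V_in_group_center_iff)

lemma inj_V: "inj_on (\<lambda>((a, c), b). V a b c) S"
  by (auto simp: inj_on_def V_inject)

lemma card_noncentral_A_group:
  "card (carrier A_group - group_center (A_group :: 'a :: {field, finite} mat monoid)) =
    (CARD('a) ^ 2 - 1) * CARD('a)"
  unfolding noncentral_A_group
  by (simp add: card_image[OF inj_V] card_cartesian_product card_Diff_singleton power2_eq_square)

text \<open>Proportionality is transitive only through a nonzero middle vector. If a' = 0, then c'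
  is nonzero and forces a = a'' = 0; otherwise a' can be cancelled.\<close>

lemma proportional_trans:
  fixes a c :: "'a :: field"
  assumes "c * a' = c' * a" "c' * a'' = c'' * a'" "a' \<noteq> 0 \<or> c' \<noteq> 0"
  shows "c * a'' = c'' * a"
proof (cases "a' = 0")
  case True
  then show ?thesis using assms by auto
next
  case False
  have "a' * (c * a'') = a' * (c'' * a)"
    using assms(1,2) by (metis mult.assoc mult.commute)
  then show ?thesis using False by simp
qed

text \<open>The solutions are the multiples of (a, c), one for each scalar.\<close>

lemma card_line:
  fixes a c :: "'a :: {field, finite}"
  assumes "(a, c) \<noteq> (0, 0)"
  shows "card {(a', c'). c * a' = c' * a} = CARD('a)"
proof -
  have "{(a', c'). c * a' = c' * a} = range (\<lambda>t. (t * a, t * c))"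
  proof (intro equalityI subsetI)
    fix x assume "x \<in> {(a', c'). c * a' = c' * a}"
    then obtain a' c' where x: "x = (a', c')" "c * a' = c' * a" by auto
    \<comment> \<open>The scalar is the quotient of whichever coordinates have a nonzero
      denominator.\<close>
    show "x \<in> range (\<lambda>t. (t * a, t * c))"
    proof (cases "a = 0")
      case True
      then show ?thesis using x assms by (intro image_eqI[of _ _ "c' / c"]) auto
    next
      case False
      then show ?thesis using x by (intro image_eqI[of _ _ "a' / a"]) (auto simp: field_simps)
    qed
  qed auto
  moreover have "inj (\<lambda>t. (t * a, t * c))" using assms by (auto simp: inj_on_def)
  ultimately show ?thesis by (simp add: card_image)
qed

text \<open>Adjacency in the commuting graph with the diagonal put back, so that the relation can be
  reflexive.\<close>

definition commuting_rel :: "('a, 'b) monoid_scheme \<Rightarrow> ('a \<times> 'a) set" where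
  "commuting_rel G = {(x, y). x \<in> carrier G - group_center G \<and> y \<in> carrier G - group_center G \<and>
     x \<otimes>\<^bsub>G\<^esub> y = y \<otimes>\<^bsub>G\<^esub> x}"

lemma V_in_commuting_rel_iff:
  "(V a b c, V a' b' c') \<in> commuting_rel A_group \<longleftrightarrow>
    (a, c) \<noteq> (0, 0) \<and> (a', c') \<noteq> (0, 0) \<and> c * a' = c' * a"
  using V_commute_iff[of a b c a' b' c']
  by (auto simp: commuting_rel_def V_in_group_center_iff) (auto simp: A_group_def)

lemma commuting_relE:
  assumes "(x, y) \<in> commuting_rel A_group"
  obtains a b c a' b' c' where "x = V a b c" "y = V a' b' c'"
  using assms by (auto simp: commuting_rel_def A_group_def)

lemma equiv_commuting_rel:
  "equiv (carrier A_group - group_center A_group) (commuting_rel (A_group :: 'a :: field mat monoid))"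
proof (rule equivI)
  show "trans (commuting_rel (A_group :: 'a mat monoid))"
  proof (rule transI)
    fix x y z :: "'a mat"
    assume xy: "(x, y) \<in> commuting_rel A_group" and yz: "(y, z) \<in> commuting_rel A_group"
    obtain a b c a' b' c' where "x = V a b c" "y = V a' b' c'"
      using xy by (rule commuting_relE)
    moreover obtain a'' b'' c'' where "z = V a'' b'' c''"
      using yz by (rule commuting_relE)
    ultimately show "(x, z) \<in> commuting_rel A_group"
      using xy yz proportional_trans[of c a' c' a a'' c''] by (simp add: V_in_commuting_rel_iff)
  qed
qed (auto simp: commuting_rel_def refl_on_def sym_def)

text \<open>The class of \<open>V a b c\<close> consists of all \<open>V a' b' c'\<close> with (a',
  c') a nonzero point of the line through (a, c) and b' arbitrary.\<close>

lemma card_commuting_class: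
  fixes x :: "'a :: {field, finite} mat"
  assumes "x \<in> carrier A_group - group_center A_group"
  shows "card (commuting_rel A_group `` {x}) = (CARD('a) - 1) * CARD('a)"
proof -
  obtain a b c where x: "x = V a b c" and ac: "(a, c) \<noteq> (0, 0)"
    using assms by (auto simp: noncentral_A_group)
  have "commuting_rel A_group `` {x} =
      (\<lambda>((a, c), b). V a b c) ` (({(a', c'). c * a' = c' * a} - {(0, 0)}) \<times> UNIV)"
  proof (intro equalityI subsetI)
    fix y assume "y \<in> commuting_rel A_group `` {x}"
    moreover from this obtain a' b' c' where "y = V a' b' c'" by (auto elim: commuting_relE)
    ultimately show "y \<in> (\<lambda>((a, c), b). V a b c) ` (({(a', c'). c * a' = c' * a} - {(0, 0)}) \<times> UNIV)"
      by (intro image_eqI[of _ _ "((a', c'), b')"]) (auto simp: x V_in_commuting_rel_iff)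
  qed (use ac in \<open>auto simp: x V_in_commuting_rel_iff\<close>)
  then show ?thesis
    by (simp add: card_image[OF inj_V] card_cartesian_product card_Diff_singleton card_line[OF ac])
qed

theorem proposition2p14:
  fixes p n :: nat
  assumes "prime p" and "n \<ge> 1"
    and "CARD('a :: {field, finite}) = p ^ n"
  shows "L_Spec (commuting_graph (A_group :: 'a mat monoid)) =
           replicate_mset (p ^ n + 1) 0 +
           replicate_mset (p ^ (3 * n) - 2 * p ^ n - 1) (of_nat p ^ (2 * n) - of_nat p ^ n)
       \<and> Q_Spec (commuting_graph (A_group :: 'a mat monoid)) =
           replicate_mset (p ^ n + 1) (2 * of_nat p ^ (2 * n) - 2 * of_nat p ^ n - 2) +
           replicate_mset (p ^ (3 * n) - 2 * p ^ n - 1) (of_nat p ^ (2 * n) - of_nat p ^ n - 2)"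
proof -
  let ?G = "commuting_graph (A_group :: 'a mat monoid)"
  define q where "q = p ^ n"
  define m where "m = (q - 1) * q"
  have q: "CARD('a) = q" using assms by (simp add: q_def)
  \<comment> \<open>A field has at least the two elements 0 and 1.\<close>
  have "card {0, 1 :: 'a} \<le> CARD('a)" by (rule card_mono) auto
  then have "q \<ge> 2" by (simp add: q)
  \<comment> \<open>Writing q as \<open>Suc r\<close> turns the truncated subtractions into ordinary
    algebra, and r \<ge> 1 makes the clique size \<open>m\<close> positive.\<close>
  then obtain r where r: "q = Suc r" "r \<ge> 1" by (cases q) auto
  have pw: "p ^ (2 * n) = q ^ 2" "p ^ (3 * n) = q ^ 3"
    by (simp_all add: q_def mult.commute flip: power_mult)
  have pverts: "pverts ?G = carrier A_group - group_center A_group"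
    by (simp add: commuting_graph_def)
  \<comment> \<open>The number of cliques comes from the factorisation q^2 - 1 = (q + 1)(q -
    1).\<close>
  have "card (pverts ?G) = (q + 1) * m"
    unfolding pverts card_noncentral_A_group q
    by (simp add: m_def r power2_eq_square algebra_simps)
  moreover have "m > 0" using r by (simp add: m_def)
  moreover have "parcs ?G = commuting_rel A_group - Id"
    by (auto simp: commuting_graph_def commuting_rel_def)
  ultimately have spec:
    "L_Spec ?G = replicate_mset (q + 1) 0 + replicate_mset ((q + 1) * m - (q + 1)) (of_nat m)"
    "Q_Spec ?G = replicate_mset (q + 1) (2 * of_nat m - 2)
       + replicate_mset ((q + 1) * m - (q + 1)) (of_nat m - 2)"
    using spectra_disjoint_cliques[of ?G "commuting_rel A_group" m "q + 1"]
      equiv_commuting_rel card_commuting_class[where 'a = 'a, unfolded q, folded m_def]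
    unfolding pverts by (simp_all add: carrier_A_group)
  have mult: "(q + 1) * m - (q + 1) = q ^ 3 - 2 * q - 1"
    by (simp add: m_def r power3_eq_cube algebra_simps)
  have "(of_nat m :: complex) = of_nat q ^ 2 - of_nat q"
    by (simp add: m_def r algebra_simps power2_eq_square)
  then have m: "(of_nat m :: complex) = of_nat p ^ (2 * n) - of_nat p ^ n"
    by (simp add: q_def mult.commute flip: power_mult)
  show ?thesis
    unfolding spec mult m pw q_def[symmetric] by (simp add: algebra_simps)
qed

end
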